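(* Let $N$ be a positive integer, let $T\in(0,\infty]$ and, for $k\in[N]$, let $x^k_\cdot,y^k_\cdot:[0,T)\to\mathbb R_{\geqslant0}$ be $C^1$ functions. Suppose that $x^{k+1}_t\geqslant x^k_t$ for all $k\in[N-1]$ and $t\in[0,T)$. Suppose that there exist an integer $\beta\geqslant2$, real numbers $c_1>c_2\geqslant0$ and $C_0\geqslant0$, and functions $M_1,M_2,M_3:[0,T)\to[0,\infty)$ such that for all $t\in[0,T)$ and $k\in[N]$, $$x^k_0\leqslant\frac{C_0k^2}{N^2},$$ $$\frac{dx^k_t}{dt}\leqslant-c_1y^k_t+c_2y^{k+1}_t\mathbf 1_{k<N}+M_1(t)x^k_t+M_2(t)\,k\bigl(x^{k+1}_t-x^k_t\bigr)\mathbf 1_{k<N}+M_3(t)\frac{k^\beta}{N^2}.$$ Then the following hold. 1. If $M_1,M_2$ are constant functions and $M_3(t)\leqslant Le^{Lt}$ for all $t\in[0,T)$, for some $L\geqslant0$, then there exists $M>0$, depending only on $\beta,c_1,c_2,C_0,M_1,M_2$ and $L$, such that for all $t\in[0,T)$ and all $k\in[N]$, $$x^k_t\leqslant Me^{Mt}\frac{k^\beta}{N^2}.$$ 2. If $T=\infty$, the functions $M_1,M_2,M_3$ are non-increasing and satisfy $M_i(t)\leqslant Le^{-\eta t}$ for all $t\in[0,\infty)$ and all $i\in\{1,2,3\}$, for some $L\geqslant0$ and $\eta>0$, and if $y^k_t\geqslant\rho x^k_t$ for all $t\in[t_*,\infty)$ and all $k\in[N]$, for some $\rho>0$ and some $t_*\geqslant0$,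 then for all $r\in\bigl(0,\rho(c_1-c_2)\bigr)$ there exists $M'\geqslant0$, depending only on $r,\eta,\beta,c_1,c_2,C_0,L,\rho$ and $t_*$, such that for all $t\in[0,\infty)$ and all $k\in[N]$, $$x^k_t\leqslant M'e^{-\min(r,\eta)t}\frac{k^\beta}{N^2}.$$
   Context: $[N]=\{1,\dots,N\}$. $\mathbf 1_{k<N}$ equals $1$ if $k<N$ and $0$ otherwise; terms multiplied by $\mathbf 1_{k<N}$ are absent when $k=N$. "Depending only on" means in particular that the constants $M$, $M'$ do not depend on $N$, $k$, $t$ or $T$. *)

theory Defs
  imports "HOL-Analysis.Analysis"
begin

text \<open>The half-open time interval from 0 to a horizon that may be infinite.\<close>

definition time_interval :: "ereal \<Rightarrow> real set" where
  "time_interval T = {t. 0 \<le> t \<and> ereal t < T}"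

text \<open>
  The library's \<open>C1_differentiable_on\<close> uses two-sided derivatives and would therefore constrain
  the function at times before 0. Here the derivative at 0 is the right derivative.
\<close>

definition C1_on :: "real set \<Rightarrow> (real \<Rightarrow> real) \<Rightarrow> bool" where
  "C1_on I f \<longleftrightarrow>
     (\<exists>f'. (\<forall>t\<in>I. (f has_real_derivative f' t) (at t within I)) \<and> continuous_on I f')"

text \<open>
  The functions are indexed by \<open>{1..N}\<close> and live on \<open>time_interval T\<close>; nothing is assumed about their
  values at other indices or times. The derivative is unique, as \<open>time_interval T\<close> has no isolated
  points when \<open>T > 0\<close>.
\<close>

definition diff_ineq_system ::
  "nat \<Rightarrow> ereal \<Rightarrow> nat \<Rightarrow> real \<Rightarrow> real \<Rightarrow> real \<Rightarrow> (real \<Rightarrow> real) \<Rightarrow> (real \<Rightarrow> real) \<Rightarrow> (real \<Rightarrow> real)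
    \<Rightarrow> (nat \<Rightarrow> real \<Rightarrow> real) \<Rightarrow> (nat \<Rightarrow> real \<Rightarrow> real) \<Rightarrow> bool" where
  "diff_ineq_system N T \<beta> c1 c2 C0 M1 M2 M3 x y \<longleftrightarrow>
     N \<ge> 1 \<and> T > 0 \<and>
     (\<forall>k\<in>{1..N}. C1_on (time_interval T) (x k) \<and> C1_on (time_interval T) (y k)) \<and>
     (\<forall>k\<in>{1..N}. \<forall>t\<in>time_interval T. x k t \<ge> 0 \<and> y k t \<ge> 0) \<and>
     (\<forall>k\<in>{1..<N}. \<forall>t\<in>time_interval T. x (k + 1) t \<ge> x k t) \<and>
     (\<forall>t\<in>time_interval T. M1 t \<ge> 0 \<and> M2 t \<ge> 0 \<and> M3 t \<ge> 0) \<and>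
     (\<forall>k\<in>{1..N}. x k 0 \<le> C0 * real k ^ 2 / real N ^ 2) \<and>
     (\<forall>t\<in>time_interval T. \<forall>k\<in>{1..N}.
        vector_derivative (x k) (at t within time_interval T)
          \<le> - c1 * y k t
            + (if k < N then c2 * y (k + 1) t else 0)
            + M1 t * x k t
            + (if k < N then M2 t * real k * (x (k + 1) t - x k t) else 0)
            + M3 t * (real k ^ \<beta> / real N ^ 2))"

end

theory Submission
  imports Defs "HOL-Real_Asymp.Real_Asymp"
begin

text \<open>
  Without the \<open>y\<close>-terms the claim is a comparison principle: since
  \<open>k * ((k + 1) ^ \<beta> - k ^ \<beta>) \<le> 2 ^ \<beta> * k ^ \<beta>\<close>, the profile \<open>\<phi> t * k ^ \<beta> / N\<^sup>2\<close> is a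
  supersolution as soon as \<open>\<phi>'\<close> dominates \<open>(M1 + 2 ^ \<beta> * M2) * \<phi> + M3\<close>. The difficulty is the
  term \<open>c2 * y (k + 1)\<close>, over which there is no control from above.

  This term telescopes against \<open>- c1 * y (k + 1)\<close> from the next inequality once the inequalities
  are summed with geometric weights. Put \<open>Z k = (\<Sum>j=k..N. q ^ (j - k) * x j)\<close> with \<open>q < 1\<close> and
  \<open>c2 \<le> q * (c1 - g)\<close>; then the \<open>y\<close>-terms contribute at most \<open>- g\<close> times the weighted sum of
  the \<open>y j\<close> (\<open>tail_damping\<close>). The weights decay geometrically, so passing from \<open>k ^ \<beta>\<close> to its
  weighted tail costs only a factor independent of \<open>N\<close> and \<open>k\<close> (\<open>tail_power_le\<close>).

  The price is that the transport term, written in terms of the weighted tails, is no longer a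
  nearest-neighbour expression. It is, however, still cooperative: the tail at \<open>k\<close> enters with
  coefficient \<open>- k\<close>, and later tails enter with nonnegative coefficients (\<open>tail_transport_ge\<close>). In
  probabilistic language, the adjoint dynamics is a Yule process stopped at \<open>N\<close>, and it preserves the cone of
  nonnegative weights \<open>w\<close> with \<open>w (j + 1) \<ge> q * w j\<close>. The system for the tails is moreover triangular, so the
  comparison principle follows by downward induction on \<open>k\<close> from a scalar one
  (\<open>weighted_tail_le_supersolution\<close>).

  Both claims are then choices of \<open>\<phi>\<close>. For the growth bound \<open>g = 0\<close> and \<open>\<phi>\<close> is an exponential. For
  the decay bound, the part \<open>- g\<close> of the damping turns into \<open>- \<rho> * g\<close> times the tail of \<open>x\<close> after
  \<open>t_star\<close>. Letting \<open>q\<close> approach 1 allows every \<open>\<rho> * g\<close> below \<open>\<rho> * (c1 - c2)\<close>, in particular one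
  strictly above \<open>r\<close>. The strict gap is what absorbs the source of order \<open>exp (- \<eta> * t)\<close>, even in the
  resonant case \<open>r = \<eta>\<close>.
\<close>

section \<open>Geometrically weighted tails\<close>

definition tail :: "nat \<Rightarrow> real \<Rightarrow> (nat \<Rightarrow> real) \<Rightarrow> nat \<Rightarrow> real" where
  "tail N q X k = (\<Sum>j=k..N. q ^ (j - k) * X j)"

definition transport :: "nat \<Rightarrow> (nat \<Rightarrow> real) \<Rightarrow> nat \<Rightarrow> real" where
  "transport N X j = (if j < N then real j * (X (j + 1) - X j) else 0)"

lemma tail_rec:
  assumes "k \<le> N"
  shows "tail N q X k = X k + q * tail N q X (Suc k)"
proof -
  have "tail N q X k = X k + (\<Sum>j=Suc k..N. q ^ (j - k) * X j)"
    using assms by (simp add: tail_def sum.atLeast_Suc_atMost)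
  also have "(\<Sum>j=Suc k..N. q ^ (j - k) * X j) = q * tail N q X (Suc k)"
    unfolding tail_def sum_distrib_left
    by (rule sum.cong) (auto simp: Suc_diff_le Suc_le_eq simp flip: power_Suc mult.assoc Suc_diff_Suc)
  finally show ?thesis .
qed

lemma tail_beyond: "N < k \<Longrightarrow> tail N q X k = 0"
  by (simp add: tail_def)

lemma tail_add: "tail N q (\<lambda>j. X j + Y j) k = tail N q X k + tail N q Y k"
  by (simp add: tail_def sum.distrib algebra_simps)

lemma tail_diff: "tail N q (\<lambda>j. X j - Y j) k = tail N q X k - tail N q Y k"
  by (simp add: tail_def sum_subtractf algebra_simps)

lemma tail_scale: "tail N q (\<lambda>j. c * X j) k = c * tail N q X k"
  by (simp add: tail_def sum_distrib_left mult.left_commute)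

lemma tail_mono:
  assumes "0 \<le> q" and "\<And>j. j \<in> {k..N} \<Longrightarrow> X j \<le> Y j"
  shows "tail N q X k \<le> tail N q Y k"
  unfolding tail_def using assms by (intro sum_mono mult_left_mono) auto

lemma tail_nonneg:
  assumes "0 \<le> q" and "\<And>j. j \<in> {k..N} \<Longrightarrow> 0 \<le> X j"
  shows "0 \<le> tail N q X k"
  unfolding tail_def using assms by (intro sum_nonneg mult_nonneg_nonneg) auto

lemma le_tail:
  assumes "0 \<le> q" and "k \<le> N" and "\<And>j. j \<in> {k..N} \<Longrightarrow> 0 \<le> X j"
  shows "X k \<le> tail N q X k"
proof -
  have "0 \<le> tail N q X (Suc k)"
    using assms by (intro tail_nonneg) auto
  then show ?thesis
    using assms by (simp add: tail_rec)
qed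

lemma tail_has_real_derivative:
  assumes "\<And>j. j \<in> {k..N} \<Longrightarrow> ((\<lambda>t. X j t) has_real_derivative X' j) (at t within I)"
  shows "((\<lambda>t. tail N q (\<lambda>j. X j t) k) has_real_derivative tail N q X' k) (at t within I)"
  unfolding tail_def using assms by (intro DERIV_sum DERIV_cmult) auto

text \<open>
  After the index in \<open>c2 * Y (j + 1)\<close> is shifted, \<open>Y j\<close> with \<open>j > k\<close> has total coefficient
  \<open>q ^ (j - k - 1) * (c2 - q * c1)\<close>, which is at most \<open>- g * q ^ (j - k)\<close>.
\<close>

lemma tail_damping:
  assumes "0 \<le> q" and "g \<le> c1" and c: "c2 \<le> q * (c1 - g)"
    and Y: "\<And>j. j \<in> {k..N} \<Longrightarrow> 0 \<le> Y j"
  shows "tail N q (\<lambda>j. - c1 * Y j + (if j < N then c2 * Y (j + 1) else 0)) k \<le> - g * tail N q Y k"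
proof (cases "k \<le> N")
  case True
  let ?F = "\<lambda>j. - c1 * Y j + (if j < N then c2 * Y (j + 1) else 0)"
  (* The surplus (c1 - g) * Y k is what absorbs c2 * Y k at the preceding index. *)
  have "tail N q ?F k \<le> - g * tail N q Y k - (c1 - g) * Y k"
    using True Y
  proof (induction k rule: inc_induct)
    case base
    then show ?case by (simp add: tail_rec tail_beyond algebra_simps)
  next
    case (step k)
    have "q * tail N q ?F (Suc k) \<le> q * (- g * tail N q Y (Suc k) - (c1 - g) * Y (Suc k))"
      using step by (intro mult_left_mono \<open>0 \<le> q\<close>) auto
    moreover have "c2 * Y (Suc k) \<le> q * (c1 - g) * Y (Suc k)"
      using step by (intro mult_right_mono c) auto
    ultimately show ?case
      using step.hyps by (simp add: tail_rec[of k] algebra_simps)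
  qed
  moreover have "0 \<le> (c1 - g) * Y k"
    using True \<open>g \<le> c1\<close> Y by simp
  ultimately show ?thesis by linarith
qed (simp add: tail_beyond)

text \<open>
  Write \<open>z\<close> for the tails of \<open>X\<close>, so that \<open>X j = z j - q * z (j + 1)\<close>. The tail of the transport term
  at \<open>k\<close> is then \<open>- k * z k + (k - q) * z (k + 1)\<close> plus terms in \<open>z m\<close> with \<open>m > k + 1\<close>. For
  \<open>m < N\<close> the coefficient of the latter is
  \<open>q ^ (m - k - 1) * ((1 + q) * (m - 1) - q * m - (m - 2)) = q ^ (m - k - 1) * (1 - q)\<close>, which is
  nonnegative. The last tail \<open>z N\<close>, also when \<open>N = k + 1\<close>, lacks the negative summand \<open>q * m\<close>
  because there is no transport at \<open>N\<close>; this only helps.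
\<close>

lemma tail_transport_ge:
  assumes q: "0 \<le> q" "q \<le> 1"
    and "k < N" and "\<And>m. m \<in> {k<..N} \<Longrightarrow> 0 \<le> tail N q X m"
  shows "(real k - q) * tail N q X (Suc k) - real k * tail N q X k \<le> tail N q (transport N X) k"
proof -
  have "k \<le> N - 1" using assms by simp
  then show ?thesis
    using assms(3-)
  proof (induction k rule: inc_induct)
    case base
    then obtain n where N: "N = Suc n" by (cases N) auto
    have "0 \<le> q * (1 + real n) * X N"
      using base(2)[of N] q by (auto simp: N tail_rec tail_beyond)
    then show ?case
      by (simp add: N tail_rec tail_beyond transport_def algebra_simps)
  next
    case (step k)
    let ?z = "tail N q X"
    have "q * ((real (Suc k) - q) * ?z (Suc (Suc k)) - real (Suc k) * ?z (Suc k))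
          \<le> q * tail N q (transport N X) (Suc k)"
      using step by (intro mult_left_mono q) auto
    moreover have "0 \<le> q * (1 - q) * ?z (Suc (Suc k))"
      using step q by (intro mult_nonneg_nonneg) auto
    moreover have "tail N q (transport N X) k
        = real k * (X (Suc k) - X k) + q * tail N q (transport N X) (Suc k)"
      using step.hyps by (simp add: tail_rec[of k] transport_def[of N X k] less_diff_conv)
    moreover have "X k = ?z k - q * ?z (Suc k)" "X (Suc k) = ?z (Suc k) - q * ?z (Suc (Suc k))"
      using step.hyps by (simp_all add: tail_rec[of k] tail_rec[of "Suc k"])
    ultimately show ?case
      by (simp add: algebra_simps)
  qed
qed

text \<open>
  The cooperative property in the form used for comparison: at the last index where the tail
  becomes negative, transport pushes it back up.
\<close>

lemma tail_transport_nonneg: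
  assumes q: "0 \<le> q" "q \<le> 1"
    and k: "1 \<le> k" "k \<le> N" and z: "\<And>m. m \<in> {k<..N} \<Longrightarrow> 0 \<le> tail N q X m"
    and neg: "tail N q X k \<le> 0"
  shows "0 \<le> tail N q (transport N X) k"
proof (cases "k < N")
  case True
  have "0 \<le> (real k - q) * tail N q X (Suc k)"
    using True k q by (intro mult_nonneg_nonneg z) auto
  moreover have "real k * tail N q X k \<le> 0"
    using neg by (simp add: mult_nonneg_nonpos)
  ultimately show ?thesis
    using tail_transport_ge[OF q True z] by linarith
next
  case False
  then show ?thesis using k by (simp add: tail_rec tail_beyond transport_def)
qed

text \<open>
  The constant \<open>2 ^ \<beta> - 1\<close>, attained at \<open>k = 1\<close>, makes the induction on \<open>\<beta>\<close> close; \<open>2 ^ \<beta>\<close> would not.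
\<close>

lemma power_increment_le:
  assumes "1 \<le> k"
  shows "real k * (real (k + 1) ^ \<beta> - real k ^ \<beta>) \<le> (2 ^ \<beta> - 1) * real k ^ \<beta>"
proof (induction \<beta>)
  case (Suc b)
  have "real k * (real (k + 1) ^ Suc b - real k ^ Suc b)
      = real (k + 1) * (real k * (real (k + 1) ^ b - real k ^ b)) + real k * real k ^ b"
    by (simp add: algebra_simps)
  also have "\<dots> \<le> real (k + 1) * ((2 ^ b - 1) * real k ^ b) + real k * real k ^ b"
    using Suc by (intro add_mono mult_left_mono) auto
  also have "\<dots> = real k ^ b * (2 ^ b * real k + (2 ^ b - 1) * 1)"
    by (simp add: algebra_simps)
  also have "\<dots> \<le> real k ^ b * (2 ^ b * real k + (2 ^ b - 1) * real k)"
    using assms by (intro mult_left_mono add_mono) auto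
  also have "\<dots> = (2 ^ Suc b - 1) * real k ^ Suc b"
    by (simp add: algebra_simps)
  finally show ?case .
qed simp

lemma tail_transport_power_le:
  assumes "0 \<le> q" and "1 \<le> k" and "0 \<le> a"
  shows "tail N q (transport N (\<lambda>j. a * real j ^ \<beta>)) k \<le> 2 ^ \<beta> * tail N q (\<lambda>j. a * real j ^ \<beta>) k"
  unfolding tail_scale[symmetric]
proof (rule tail_mono[OF \<open>0 \<le> q\<close>])
  fix j assume "j \<in> {k..N}"
  then have "real j * (real (j + 1) ^ \<beta> - real j ^ \<beta>) \<le> (2 ^ \<beta> - 1) * real j ^ \<beta>"
    using assms by (intro power_increment_le) auto
  also have "\<dots> \<le> 2 ^ \<beta> * real j ^ \<beta>"
    by (intro mult_right_mono) auto
  finally have "a * (real j * (real (j + 1) ^ \<beta> - real j ^ \<beta>)) \<le> a * (2 ^ \<beta> * real j ^ \<beta>)"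
    using assms by (intro mult_left_mono) auto
  then show "transport N (\<lambda>j. a * real j ^ \<beta>) j \<le> 2 ^ \<beta> * (a * real j ^ \<beta>)"
    using assms by (auto simp: transport_def algebra_simps)
qed

lemma summable_geometric_moment:
  assumes "0 < q" and "q < (1::real)"
  shows "summable (\<lambda>i. q ^ i * real (i + 1) ^ \<beta>)"
proof (rule summable_comparison_test_bigo)
  show "summable (\<lambda>i. norm (((1 + q) / 2) ^ i))"
    using assms by (simp add: summable_geometric)
  show "(\<lambda>i. q ^ i * real (i + 1) ^ \<beta>) \<in> O(\<lambda>i. ((1 + q) / 2) ^ i)"
    using assms by real_asymp
qed

text \<open>
  For \<open>k \<ge> 1\<close> one has \<open>k + i \<le> (i + 1) * k\<close>, so the tail of a power is at most that power times a
  moment of the geometric weights. The full series is used as the constant because it depends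
  neither on \<open>N\<close> nor on \<open>k\<close>.
\<close>

lemma tail_power_le:
  assumes q: "0 < q" "q < 1" and "1 \<le> k" and "0 \<le> a"
  shows "tail N q (\<lambda>j. a * real j ^ \<beta>) k \<le> (\<Sum>i. q ^ i * real (i + 1) ^ \<beta>) * (a * real k ^ \<beta>)"
proof -
  have "tail N q (\<lambda>j. a * real j ^ \<beta>) k
      \<le> (\<Sum>j=k..N. q ^ (j - k) * (a * (real (j - k + 1) * real k) ^ \<beta>))"
    unfolding tail_def
  proof (intro sum_mono mult_left_mono power_mono)
    fix j assume "j \<in> {k..N}"
    then obtain i where j: "j = k + i" using le_Suc_ex by auto
    have "real i * 1 \<le> real i * real k" using assms by (intro mult_left_mono) auto
    then show "real j \<le> real (j - k + 1) * real k" by (simp add: j algebra_simps)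
  qed (use assms in auto)
  also have "\<dots> = (\<Sum>j=k..N. q ^ (j - k) * real (j - k + 1) ^ \<beta>) * (a * real k ^ \<beta>)"
    unfolding sum_distrib_right power_mult_distrib by (simp only: mult_ac)
  also have "(\<Sum>j=k..N. q ^ (j - k) * real (j - k + 1) ^ \<beta>)
      = (\<Sum>i\<in>(\<lambda>j. j - k) ` {k..N}. q ^ i * real (i + 1) ^ \<beta>)"
    by (subst sum.reindex) (auto simp: inj_on_def)
  also have "\<dots> \<le> (\<Sum>i. q ^ i * real (i + 1) ^ \<beta>)"
    using q by (intro sum_le_suminf summable_geometric_moment) auto
  finally show ?thesis using assms by (simp add: mult_right_mono)
qed

section \<open>Comparison with a supersolution\<close>

text \<open>
  After multiplication by \<open>exp (- A * t)\<close> the function is nondecreasing wherever it is negative, so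
  it cannot descend from its last nonnegative value to a negative one.
\<close>

lemma nonneg_if_derivative_ge_when_negative:
  fixes f f' :: "real \<Rightarrow> real"
  assumes deriv: "\<And>t. t \<in> {a..b} \<Longrightarrow> (f has_real_derivative f' t) (at t within {a..b})"
    and init: "0 \<le> f a"
    and ge: "\<And>t. t \<in> {a..b} \<Longrightarrow> f t < 0 \<Longrightarrow> A * f t \<le> f' t"
    and "a \<le> b"
  shows "0 \<le> f b"
proof (rule ccontr)
  assume "\<not> 0 \<le> f b"
  define h where "h t = exp (- A * t) * f t" for t
  define h' where "h' t = exp (- A * t) * (f' t - A * f t)" for t
  have dh: "(h has_real_derivative h' t) (at t within {a..b})" if "t \<in> {a..b}" for t
    unfolding h_def h'_def using deriv[OF that]
    by (auto intro!: derivative_eq_intros simp: algebra_simps)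
  define S where "S = {a..b} \<inter> h -` {0..}"
  have "continuous_on {a..b} h"
    using dh by (rule DERIV_continuous_on)
  then have "closed S"
    unfolding S_def by (rule continuous_closed_preimage) simp_all
  moreover have "bounded S"
    by (rule bounded_subset[of "{a..b}"]) (auto simp: S_def)
  ultimately have "compact S"
    by (simp add: compact_eq_bounded_closed)
  moreover have "S \<noteq> {}"
    using init \<open>a \<le> b\<close> by (auto simp: S_def h_def)
  ultimately obtain s where s: "s \<in> S" "\<And>t. t \<in> S \<Longrightarrow> t \<le> s"
    using compact_attains_sup[of S] by auto
  have "h b < 0"
    using \<open>\<not> 0 \<le> f b\<close> by (simp add: h_def mult_pos_neg)
  then have "s < b" "a \<le> s" "0 \<le> h s"
    using s(1) by (auto simp: S_def intro: le_neq_trans)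
  have "\<exists>\<xi>\<in>{s<..<b}. h b - h s = (*) (h' \<xi>) (b - s)"
  proof (rule mvt_simple[OF \<open>s < b\<close>])
    fix t assume "s \<le> t" "t \<le> b"
    then show "(h has_derivative (*) (h' t)) (at t within {s..b})"
      using dh[of t] \<open>a \<le> s\<close> has_derivative_subset[of h _ t "{a..b}" "{s..b}"]
      by (auto simp: has_field_derivative_def)
  qed
  then obtain \<xi> where \<xi>: "s < \<xi>" "\<xi> < b" "h b - h s = h' \<xi> * (b - s)"
    by auto
  have "h \<xi> < 0"
    using \<xi> s(2)[of \<xi>] \<open>a \<le> s\<close> by (force simp: S_def)
  then have "f \<xi> < 0"
    by (simp add: h_def mult_less_0_iff)
  then have "0 \<le> h' \<xi>"
    using ge[of \<xi>] \<xi> \<open>a \<le> s\<close> by (simp add: h'_def)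
  then have "0 \<le> h b - h s"
    using \<xi> by simp
  then show False
    using \<open>h b < 0\<close> \<open>0 \<le> h s\<close> by simp
qed

lemma C1_on_imp_has_real_derivative:
  assumes "C1_on I f" and "t \<in> I"
  shows "(f has_real_derivative vector_derivative f (at t within I)) (at t within I)"
proof -
  have "f differentiable at t within I"
    using assms by (auto simp: C1_on_def has_real_derivative_iff_has_vector_derivative
        intro: differentiableI_vector)
  then show ?thesis
    by (simp add: vector_derivative_works has_real_derivative_iff_has_vector_derivative)
qed

text \<open>
  The comparison principle. Write \<open>z k\<close> for the tail of \<open>\<phi> t * j ^ \<beta> / N\<^sup>2 - x j t\<close>. Where \<open>z k\<close> is
  negative and all later tails are nonnegative, the transport contribution to its derivative is
  nonnegative, so the derivative is at least \<open>A * z k\<close> and the scalar principle applies. The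
  function \<open>\<gamma>\<close> is the damping rate that the \<open>y\<close>-terms impose on \<open>x\<close>; it is a function of time
  because a lower bound on \<open>y\<close> may be available only from some time on.
\<close>

lemma weighted_tail_le_supersolution:
  fixes \<beta> :: nat
  assumes sys: "diff_ineq_system N T \<beta> c1 c2 C0 M1 M2 M3 x y"
    and \<beta>: "2 \<le> \<beta>" and C0: "0 \<le> C0"
    and q: "0 \<le> q" "q \<le> 1" and g: "g \<le> c1" and c: "c2 \<le> q * (c1 - g)"
    and \<gamma>: "\<And>t. t \<in> time_interval T \<Longrightarrow> 0 \<le> \<gamma> t"
    and \<gamma>_le: "\<And>t k. t \<in> time_interval T \<Longrightarrow> k \<in> {1..N} \<Longrightarrow> \<gamma> t * x k t \<le> g * y k t"
    and M1: "\<And>t. t \<in> time_interval T \<Longrightarrow> M1 t \<le> A"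
    and \<phi>: "\<And>t. t \<in> time_interval T \<Longrightarrow> 0 \<le> \<phi> t"
    and d\<phi>: "\<And>t. t \<in> time_interval T \<Longrightarrow> (\<phi> has_real_derivative \<phi>' t) (at t)"
    and \<phi>': "\<And>t. t \<in> time_interval T \<Longrightarrow> (M1 t + 2 ^ \<beta> * M2 t - \<gamma> t) * \<phi> t + M3 t \<le> \<phi>' t"
    and \<phi>0: "C0 \<le> \<phi> 0"
    and t: "t \<in> time_interval T" and k: "1 \<le> k" "k \<le> N"
  shows "tail N q (\<lambda>j. x j t) k \<le> \<phi> t * tail N q (\<lambda>j. real j ^ \<beta> / real N ^ 2) k"
proof -
  let ?I = "time_interval T"
  define p where "p j = 1 / real N ^ 2 * real j ^ \<beta>" for j
  define X where "X t = (\<lambda>j. \<phi> t * p j - x j t)" for t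
  define dx where "dx t j = vector_derivative (x j) (at t within ?I)" for t j
  define z where "z k t = tail N q (X t) k" for k t
  define z' where "z' k t = tail N q (\<lambda>j. \<phi>' t * p j - dx t j) k" for k t
  have I: "{0..b} \<subseteq> ?I" if "b \<in> ?I" for b
  proof
    fix s assume "s \<in> {0..b}"
    moreover have "ereal b < T" using that by (simp add: time_interval_def)
    ultimately show "s \<in> ?I"
      using order.strict_trans1[of "ereal s" "ereal b" T] by (simp add: time_interval_def)
  qed
  have nonneg: "0 \<le> x j t" "0 \<le> y j t" if "t \<in> ?I" "j \<in> {1..N}" for j t
    using sys that by (auto simp: diff_ineq_system_def)
  have M: "0 \<le> M1 t" "0 \<le> M2 t" "0 \<le> M3 t" if "t \<in> ?I" for t
    using sys that by (auto simp: diff_ineq_system_def)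
  have ineq: "\<forall>t\<in>?I. \<forall>j\<in>{1..N}. vector_derivative (x j) (at t within ?I) \<le>
      - c1 * y j t + (if j < N then c2 * y (j + 1) t else 0) + M1 t * x j t
        + (if j < N then M2 t * real j * (x (j + 1) t - x j t) else 0)
        + M3 t * (real j ^ \<beta> / real N ^ 2)"
    using sys unfolding diff_ineq_system_def by (elim conjE)
  have dx: "dx t j \<le> (- c1 * y j t + (if j < N then c2 * y (j + 1) t else 0))
      + M1 t * x j t + M2 t * transport N (\<lambda>j. x j t) j + M3 t * p j"
    if "t \<in> ?I" "j \<in> {1..N}" for t j
  proof -
    have "dx t j \<le> - c1 * y j t + (if j < N then c2 * y (j + 1) t else 0) + M1 t * x j t
        + (if j < N then M2 t * real j * (x (j + 1) t - x j t) else 0)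
        + M3 t * (real j ^ \<beta> / real N ^ 2)"
      using ineq that unfolding dx_def by blast
    then show ?thesis
      by (simp add: transport_def p_def split: if_splits)
  qed
  have dz: "(z k has_real_derivative z' k t) (at t within ?I)"
    if "t \<in> ?I" "1 \<le> k" for t k
    unfolding z_def z'_def X_def
  proof (rule tail_has_real_derivative)
    fix j assume "j \<in> {k..N}"
    then have "(x j has_real_derivative dx t j) (at t within ?I)"
      using sys that C1_on_imp_has_real_derivative[of ?I "x j" t]
      by (auto simp: diff_ineq_system_def dx_def)
    moreover have "(\<phi> has_real_derivative \<phi>' t) (at t within ?I)"
      using d\<phi>[OF that(1)] by (rule has_field_derivative_at_within)
    ultimately show "((\<lambda>t. \<phi> t * p j - x j t) has_real_derivative \<phi>' t * p j - dx t j) (at t within ?I)"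
      by (auto intro!: derivative_eq_intros)
  qed
  have z'_ge: "A * z k t \<le> z' k t"
    if t: "t \<in> ?I" and k: "1 \<le> k" "k \<le> N" and neg: "z k t < 0"
      and later: "\<And>m. m \<in> {k<..N} \<Longrightarrow> 0 \<le> z m t" for t k
  proof -
    let ?p = "tail N q p k" and ?x = "tail N q (\<lambda>j. x j t) k"
    let ?Sp = "tail N q (transport N p) k" and ?Sx = "tail N q (transport N (\<lambda>j. x j t)) k"
    have zk: "z k t = \<phi> t * ?p - ?x"
      by (simp add: z_def X_def tail_diff tail_scale)
    have p_nonneg: "0 \<le> ?p"
      using q by (intro tail_nonneg) (auto simp: p_def)
    have "tail N q (dx t) k \<le> tail N q (\<lambda>j. (- c1 * y j t + (if j < N then c2 * y (j + 1) t else 0))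
        + M1 t * x j t + M2 t * transport N (\<lambda>j. x j t) j + M3 t * p j) k"
      using t k q by (intro tail_mono dx) auto
    also have "\<dots> = tail N q (\<lambda>j. - c1 * y j t + (if j < N then c2 * y (j + 1) t else 0)) k
        + M1 t * ?x + M2 t * ?Sx + M3 t * ?p"
      by (simp only: tail_add tail_scale)
    also have "tail N q (\<lambda>j. - c1 * y j t + (if j < N then c2 * y (j + 1) t else 0)) k
        \<le> - g * tail N q (\<lambda>j. y j t) k"
      using t k q g c by (intro tail_damping nonneg) auto
    also have "- g * tail N q (\<lambda>j. y j t) k \<le> - \<gamma> t * ?x"
      using t k q tail_mono[of q k N "\<lambda>j. \<gamma> t * x j t" "\<lambda>j. g * y j t"] \<gamma>_le
      by (simp add: tail_scale)
    finally have dx_le: "tail N q (dx t) k \<le> - \<gamma> t * ?x + M1 t * ?x + M2 t * ?Sx + M3 t * ?p"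
      by simp
    have "transport N (X t) = (\<lambda>j. \<phi> t * transport N p j - transport N (\<lambda>j. x j t) j)"
      by (auto simp: fun_eq_iff transport_def X_def algebra_simps)
    then have "tail N q (transport N (X t)) k = \<phi> t * ?Sp - ?Sx"
      by (simp add: tail_diff tail_scale)
    moreover have "0 \<le> tail N q (transport N (X t)) k"
      using q k neg later by (intro tail_transport_nonneg) (auto simp: z_def)
    moreover have "?Sp \<le> 2 ^ \<beta> * ?p"
      unfolding p_def using q k by (intro tail_transport_power_le) auto
    then have "\<phi> t * ?Sp \<le> \<phi> t * (2 ^ \<beta> * ?p)"
      using \<phi>[OF t] by (rule mult_left_mono)
    ultimately have "?Sx \<le> \<phi> t * (2 ^ \<beta> * ?p)"
      by linarith
    then have S: "M2 t * ?Sx \<le> M2 t * (\<phi> t * (2 ^ \<beta> * ?p))"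
      using M[OF t] by (intro mult_left_mono)
    have "((M1 t + 2 ^ \<beta> * M2 t - \<gamma> t) * \<phi> t + M3 t) * ?p \<le> \<phi>' t * ?p"
      using \<phi>'[OF t] p_nonneg by (rule mult_right_mono)
    then have "(M1 t - \<gamma> t) * z k t \<le> z' k t"
      using dx_le S by (simp add: z'_def zk tail_diff tail_scale algebra_simps)
    (* z k t is negative, so replacing its coefficient by an upper bound decreases the product;
       a one-sided bound on the coefficient is enough. *)
    moreover have "A * z k t \<le> (M1 t - \<gamma> t) * z k t"
      using neg M1[OF t] \<gamma>[OF t] by (intro mult_right_mono_neg) auto
    ultimately show ?thesis by simp
  qed
  have z0: "0 \<le> z k 0" if "1 \<le> k" for k
    unfolding z_def X_def
  proof (rule tail_nonneg[OF q(1)])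
    fix j assume j: "j \<in> {k..N}"
    then have "x j 0 \<le> C0 * (real j ^ 2 / real N ^ 2)"
      using sys that by (auto simp: diff_ineq_system_def)
    also have "\<dots> \<le> C0 * p j"
      unfolding p_def using j that \<beta> C0
      by (intro mult_left_mono) (auto intro!: divide_right_mono power_increasing)
    also have "\<dots> \<le> \<phi> 0 * p j"
      using \<phi>0 by (intro mult_right_mono) (auto simp: p_def)
    finally show "0 \<le> \<phi> 0 * p j - x j 0" by simp
  qed
  have "\<forall>t\<in>?I. 0 \<le> z k t"
    using k
  proof (induction k rule: measure_induct_rule[where f = "\<lambda>k. N - k"])
    case (less k)
    show ?case
    proof
      fix b assume b: "b \<in> ?I"
      have later: "0 \<le> z m s" if "m \<in> {k<..N}" "s \<in> ?I" for m s
        using less that by auto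
      show "0 \<le> z k b"
      proof (rule nonneg_if_derivative_ge_when_negative[where a = 0 and f = "z k" and f' = "z' k"])
        show "(z k has_real_derivative z' k s) (at s within {0..b})" if "s \<in> {0..b}" for s
          using dz[of s k] I[OF b] that less.prems by (blast intro: DERIV_subset)
        show "0 \<le> z k 0"
          using less.prems by (intro z0)
        show "A * z k s \<le> z' k s" if "s \<in> {0..b}" "z k s < 0" for s
          using I[OF b] that less.prems later by (intro z'_ge) auto
        show "0 \<le> b"
          using b by (simp add: time_interval_def)
      qed
    qed
  qed
  then have "0 \<le> z k t" using t by blast
  moreover have "p = (\<lambda>j. real j ^ \<beta> / real N ^ 2)"
    by (simp add: p_def fun_eq_iff)
  ultimately show ?thesis
    by (simp only: z_def X_def tail_diff tail_scale)
qed

lemma le_supersolution: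
  fixes \<beta> :: nat
  assumes sys: "diff_ineq_system N T \<beta> c1 c2 C0 M1 M2 M3 x y"
    and \<beta>: "2 \<le> \<beta>" and C0: "0 \<le> C0"
    and q: "0 < q" "q < 1" and g: "g \<le> c1" and c: "c2 \<le> q * (c1 - g)"
    and \<gamma>: "\<And>t. t \<in> time_interval T \<Longrightarrow> 0 \<le> \<gamma> t"
    and \<gamma>_le: "\<And>t k. t \<in> time_interval T \<Longrightarrow> k \<in> {1..N} \<Longrightarrow> \<gamma> t * x k t \<le> g * y k t"
    and M1: "\<And>t. t \<in> time_interval T \<Longrightarrow> M1 t \<le> A"
    and \<phi>: "\<And>t. t \<in> time_interval T \<Longrightarrow> 0 \<le> \<phi> t"
    and d\<phi>: "\<And>t. t \<in> time_interval T \<Longrightarrow> (\<phi> has_real_derivative \<phi>' t) (at t)"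
    and \<phi>': "\<And>t. t \<in> time_interval T \<Longrightarrow> (M1 t + 2 ^ \<beta> * M2 t - \<gamma> t) * \<phi> t + M3 t \<le> \<phi>' t"
    and \<phi>0: "C0 \<le> \<phi> 0"
    and t: "t \<in> time_interval T" and k: "k \<in> {1..N}"
  shows "x k t \<le> \<phi> t * (\<Sum>i. q ^ i * real (i + 1) ^ \<beta>) * (real k ^ \<beta> / real N ^ 2)"
proof -
  have "x k t \<le> tail N q (\<lambda>j. x j t) k"
    using sys q k t by (intro le_tail) (auto simp: diff_ineq_system_def)
  also have "\<dots> \<le> \<phi> t * tail N q (\<lambda>j. real j ^ \<beta> / real N ^ 2) k"
    using k q
    by (intro weighted_tail_le_supersolution[OF sys \<beta> C0 _ _ g c \<gamma> \<gamma>_le M1 \<phi> d\<phi> \<phi>' \<phi>0 t]) auto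
  also have "\<dots> \<le> \<phi> t * ((\<Sum>i. q ^ i * real (i + 1) ^ \<beta>) * (real k ^ \<beta> / real N ^ 2))"
    using tail_power_le[OF q, of k "1 / real N ^ 2" N \<beta>] k \<phi>[OF t]
    by (intro mult_left_mono) auto
  finally show ?thesis by (simp add: mult.assoc)
qed

text \<open>
  For \<open>c2 > 0\<close> the natural choice is \<open>c2 / c\<close>; the maximum with \<open>1 / 2\<close> keeps \<open>q\<close> positive when
  \<open>c2 = 0\<close>.
\<close>

lemma obtain_tail_weight:
  fixes c c2 :: real
  assumes "0 \<le> c2" and "c2 < c"
  obtains q where "0 < q" "q < 1" "c2 \<le> q * c"
proof
  show "0 < max (1 / 2) (c2 / c)" "max (1 / 2) (c2 / c) < 1"
    using assms by auto
  have "c2 = c2 / c * c" using assms by simp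
  also have "\<dots> \<le> max (1 / 2) (c2 / c) * c"
    using assms by (intro mult_right_mono) auto
  finally show "c2 \<le> max (1 / 2) (c2 / c) * c" .
qed

lemma one_le_geometric_moment:
  assumes "0 < q" and "q < (1::real)"
  shows "1 \<le> (\<Sum>i. q ^ i * real (i + 1) ^ \<beta>)"
  using sum_le_suminf[OF summable_geometric_moment[OF assms, of \<beta>], of "{0}"] assms by simp

section \<open>Growth and decay bounds\<close>

theorem proposition5:
  fixes \<beta> :: nat and c1 c2 C0 :: real
  assumes "\<beta> \<ge> 2" and "c1 > c2" and "c2 \<ge> 0" and "C0 \<ge> 0"
  shows
    "(\<forall>m1 m2 L :: real. m1 \<ge> 0 \<and> m2 \<ge> 0 \<and> L \<ge> 0 \<longrightarrow>
       (\<exists>M>0. \<forall>(N :: nat) (T :: ereal) M1 M2 M3 x y.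
          diff_ineq_system N T \<beta> c1 c2 C0 M1 M2 M3 x y \<and>
          (\<forall>t\<in>time_interval T. M1 t = m1 \<and> M2 t = m2 \<and> M3 t \<le> L * exp (L * t)) \<longrightarrow>
          (\<forall>t\<in>time_interval T. \<forall>k\<in>{1..N}.
             x k t \<le> M * exp (M * t) * (real k ^ \<beta> / real N ^ 2))))
     \<and>
     (\<forall>L \<eta> \<rho> t_star r :: real.
       L \<ge> 0 \<and> \<eta> > 0 \<and> \<rho> > 0 \<and> t_star \<ge> 0 \<and> r \<in> {0<..<\<rho> * (c1 - c2)} \<longrightarrow>
       (\<exists>M'\<ge>0. \<forall>(N :: nat) M1 M2 M3 x y.
          diff_ineq_system N \<infinity> \<beta> c1 c2 C0 M1 M2 M3 x y \<and>
          antimono_on {0..} M1 \<and> antimono_on {0..} M2 \<and> antimono_on {0..} M3 \<and>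
          (\<forall>t\<ge>0. M1 t \<le> L * exp (- \<eta> * t) \<and> M2 t \<le> L * exp (- \<eta> * t)
                 \<and> M3 t \<le> L * exp (- \<eta> * t)) \<and>
          (\<forall>t\<ge>t_star. \<forall>k\<in>{1..N}. y k t \<ge> \<rho> * x k t) \<longrightarrow>
          (\<forall>t\<ge>0. \<forall>k\<in>{1..N}.
             x k t \<le> M' * exp (- min r \<eta> * t) * (real k ^ \<beta> / real N ^ 2))))"
proof (intro conjI allI impI, goal_cases)
  case (1 m1 m2 L)
  obtain q where q: "0 < q" "q < 1" "c2 \<le> q * (c1 - 0)"
    using obtain_tail_weight[of c2 c1] assms by auto
  define \<Psi> where "\<Psi> = (\<Sum>i. q ^ i * real (i + 1) ^ \<beta>)"
  (* The summand L makes exp (K * t) also dominate the source L * exp (L * t). *)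
  define K where "K = m1 + 2 ^ \<beta> * m2 + L"
  define M where "M = (C0 + 1) * \<Psi> + K"
  have \<Psi>: "1 \<le> \<Psi>"
    unfolding \<Psi>_def using q by (intro one_le_geometric_moment)
  have K: "0 \<le> K" "L \<le> K"
    using 1 by (auto simp: K_def)
  have pos: "0 < (C0 + 1) * \<Psi>"
    using \<Psi> assms by (intro mult_pos_pos) auto
  show ?case
  proof (intro exI[of _ M] conjI allI impI ballI, goal_cases)
    case 1
    show ?case using pos K by (simp add: M_def)
  next
    case (2 N T M1 M2 M3 x y t k)
    let ?\<phi> = "\<lambda>t. (C0 + 1) * exp (K * t)"
    have "x k t \<le> ?\<phi> t * \<Psi> * (real k ^ \<beta> / real N ^ 2)"
      unfolding \<Psi>_def
    proof (rule le_supersolution[where T = T and g = 0 and \<gamma> = "\<lambda>_. 0" and A = m1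
          and \<phi> = ?\<phi> and t = t and \<phi>' = "\<lambda>t. K * ?\<phi> t"])
      show "diff_ineq_system N T \<beta> c1 c2 C0 M1 M2 M3 x y"
        using 2 by blast
      show "(?\<phi> has_real_derivative K * ?\<phi> s) (at s)" for s
        by (auto intro!: derivative_eq_intros)
      show "(M1 s + 2 ^ \<beta> * M2 s - 0) * ?\<phi> s + M3 s \<le> K * ?\<phi> s" if s: "s \<in> time_interval T" for s
      proof -
        have "M3 s \<le> L * exp (L * s)"
          using 2 s by blast
        also have "\<dots> \<le> L * (1 * exp (K * s))"
          using s K \<open>m1 \<ge> 0 \<and> m2 \<ge> 0 \<and> L \<ge> 0\<close>
          by (intro mult_left_mono) (auto simp: time_interval_def mult_right_mono)
        also have "\<dots> \<le> L * ?\<phi> s"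
          using assms \<open>m1 \<ge> 0 \<and> m2 \<ge> 0 \<and> L \<ge> 0\<close> by (intro mult_left_mono mult_right_mono) auto
        finally show ?thesis
          using 2 s by (simp add: K_def algebra_simps)
      qed
    qed (use 2 q assms in auto)
    also have "?\<phi> t * \<Psi> = (C0 + 1) * \<Psi> * exp (K * t)"
      by simp
    also have "\<dots> \<le> M * exp (M * t)"
      using K pos 2 by (intro mult_mono) (auto simp: M_def time_interval_def mult_right_mono)
    finally show ?case
      by (simp add: mult_right_mono divide_right_mono)
  qed
next
  case (2 L \<eta> \<rho> t_star r)
  then have hyp: "0 \<le> L" "0 < \<eta>" "0 < \<rho>" "0 \<le> t_star" "0 < r" "r < \<rho> * (c1 - c2)"
    by auto
  then obtain r' where r': "r < r'" "r' < \<rho> * (c1 - c2)"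
    using dense by blast
  then have "r' / \<rho> < c1 - c2"
    using hyp by (simp add: pos_divide_less_eq mult.commute)
  obtain q where q: "0 < q" "q < 1" "c2 \<le> q * (c1 - r' / \<rho>)"
    using obtain_tail_weight[of c2 "c1 - r' / \<rho>"] \<open>r' / \<rho> < c1 - c2\<close> assms by auto
  define \<Psi> where "\<Psi> = (\<Sum>i. q ^ i * real (i + 1) ^ \<beta>)"
  (* The factor exp (- B / \<eta> * exp (- \<eta> * t)) of \<phi> has logarithmic derivative
     B * exp (- \<eta> * t) and stays between exp (- B / \<eta>) and 1. It absorbs the integrable growth
     rates M1 and 2 ^ \<beta> * M2 through the first summand of B. The second summand makes
     B * exp (- \<eta> * t) exceed these rates by r' before t_star, which stands in for the damping
     that is available only afterwards. What remains is the gap r' - \<mu>, and P is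
     chosen so that (r' - \<mu>) * \<phi> bounds the source M3. *)
  define \<mu> where "\<mu> = min r \<eta>"
  define B where "B = (1 + 2 ^ \<beta>) * L + r' * exp (\<eta> * t_star)"
  define P where "P = C0 + L / (r' - \<mu>)"
  define \<phi> where "\<phi> t = P * exp (B / \<eta>) * exp (- \<mu> * t - B / \<eta> * exp (- \<eta> * t))" for t
  have \<mu>: "\<mu> \<le> \<eta>" "0 < r' - \<mu>"
    using r' by (auto simp: \<mu>_def)
  have B: "0 \<le> B"
    using hyp r' by (auto simp: B_def intro!: add_nonneg_nonneg)
  have "0 \<le> (r' - \<mu>) * C0" "0 \<le> L / (r' - \<mu>)"
    using hyp \<mu> assms by auto
  moreover have "(r' - \<mu>) * P = (r' - \<mu>) * C0 + L"
    using \<mu> by (simp add: P_def distrib_left)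
  ultimately have P: "C0 \<le> P" "L \<le> (r' - \<mu>) * P" "0 \<le> P"
    using assms by (auto simp: P_def)
  have \<Psi>: "1 \<le> \<Psi>"
    unfolding \<Psi>_def using q by (intro one_le_geometric_moment)
  have \<phi>_ge: "P * exp (- \<mu> * t) \<le> \<phi> t" if "0 \<le> t" for t
  proof -
    have "B / \<eta> * exp (- \<eta> * t) \<le> B / \<eta> * 1"
      using that hyp B by (intro mult_left_mono) auto
    then have "P * exp (- \<mu> * t) \<le> P * exp (B / \<eta> + (- \<mu> * t - B / \<eta> * exp (- \<eta> * t)))"
      using P by (intro mult_left_mono) auto
    then show ?thesis
      by (simp only: \<phi>_def exp_add mult.assoc)
  qed
  show ?case
  proof (intro exI[of _ "P * exp (B / \<eta>) * \<Psi>"] conjI allI impI ballI, goal_cases)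
    case 1
    show ?case using P \<Psi> by simp
  next
    case (2 N M1 M2 M3 x y t k)
    have I: "time_interval \<infinity> = {0..}"
      by (auto simp: time_interval_def)
    let ?\<gamma> = "\<lambda>t. if t_star \<le> t then r' else 0"
    have "x k t \<le> \<phi> t * \<Psi> * (real k ^ \<beta> / real N ^ 2)"
      unfolding \<Psi>_def
    proof (rule le_supersolution[where g = "r' / \<rho>" and \<gamma> = ?\<gamma> and A = L
          and T = \<infinity> and \<phi> = \<phi> and t = t and \<phi>' = "\<lambda>t. (B * exp (- \<eta> * t) - \<mu>) * \<phi> t"])
      show "diff_ineq_system N \<infinity> \<beta> c1 c2 C0 M1 M2 M3 x y"
        using 2 by blast
      show "?\<gamma> s * x j s \<le> r' / \<rho> * y j s" if "s \<in> time_interval \<infinity>" "j \<in> {1..N}" for s j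
      proof (cases "t_star \<le> s")
        case True
        then have "r' / \<rho> * (\<rho> * x j s) \<le> r' / \<rho> * y j s"
          using 2 that hyp r' by (intro mult_left_mono) auto
        then show ?thesis using True hyp by simp
      next
        case False
        have "0 \<le> y j s" using 2 that by (auto simp: diff_ineq_system_def)
        then show ?thesis using False hyp r' by simp
      qed
      show "M1 s \<le> L" if "s \<in> time_interval \<infinity>" for s
      proof -
        have "M1 s \<le> L * exp (- \<eta> * s)" using 2 that I by auto
        also have "\<dots> \<le> L * 1" using that hyp I by (intro mult_left_mono) auto
        finally show ?thesis by simp
      qed
      show "(\<phi> has_real_derivative (B * exp (- \<eta> * s) - \<mu>) * \<phi> s) (at s)" for s
        unfolding \<phi>_def using hyp by (auto intro!: derivative_eq_intros simp: field_simps)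
      show \<phi>_nonneg: "0 \<le> \<phi> s" for s
        using P by (simp add: \<phi>_def)
      show "(M1 s + 2 ^ \<beta> * M2 s - ?\<gamma> s) * \<phi> s + M3 s \<le> (B * exp (- \<eta> * s) - \<mu>) * \<phi> s"
        if s: "s \<in> time_interval \<infinity>" for s
      proof -
        let ?e = "exp (- \<eta> * s)"
        have M: "M1 s \<le> L * ?e" "M2 s \<le> L * ?e" "M3 s \<le> L * ?e" and "0 \<le> s"
          using 2 s I by auto
        have "r' \<le> r' * exp (\<eta> * t_star) * ?e + ?\<gamma> s"
        proof (cases "t_star \<le> s")
          case False
          then have "r' * 1 \<le> r' * exp (\<eta> * t_star + - \<eta> * s)"
            using hyp r' by (intro mult_left_mono) auto
          then show ?thesis using False by (simp only: exp_add mult.assoc) simp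
        qed (use hyp r' in simp)
        moreover have "2 ^ \<beta> * M2 s \<le> 2 ^ \<beta> * (L * ?e)"
          using M by (intro mult_left_mono) auto
        moreover have "B * ?e = L * ?e + 2 ^ \<beta> * (L * ?e) + r' * exp (\<eta> * t_star) * ?e"
          by (simp add: B_def algebra_simps)
        ultimately have "M1 s + 2 ^ \<beta> * M2 s - ?\<gamma> s \<le> B * ?e - r'"
          using M(1) by linarith
        then have "(M1 s + 2 ^ \<beta> * M2 s - ?\<gamma> s) * \<phi> s \<le> (B * ?e - r') * \<phi> s"
          using \<phi>_nonneg by (rule mult_right_mono)
        moreover have "M3 s \<le> (r' - \<mu>) * \<phi> s"
        proof -
          have "M3 s \<le> L * ?e" by (fact M)
          also have "\<dots> \<le> ((r' - \<mu>) * P) * exp (- \<mu> * s)"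
            using P hyp \<mu> \<open>0 \<le> s\<close> by (intro mult_mono) (auto simp: mult_right_mono)
          also have "\<dots> \<le> (r' - \<mu>) * \<phi> s"
            using \<phi>_ge[OF \<open>0 \<le> s\<close>] \<mu> by (simp add: mult.assoc)
          finally show ?thesis .
        qed
        ultimately show ?thesis by (simp add: algebra_simps)
      qed
      show "r' / \<rho> \<le> c1" using \<open>r' / \<rho> < c1 - c2\<close> assms by linarith
      show "C0 \<le> \<phi> 0" using \<phi>_ge[of 0] P by simp
    qed (use 2 q hyp r' assms I in auto)
    also have "\<dots> \<le> P * exp (B / \<eta>) * exp (- \<mu> * t) * \<Psi> * (real k ^ \<beta> / real N ^ 2)"
      unfolding \<phi>_def using P B hyp \<Psi> by (intro mult_right_mono mult_left_mono) auto
    finally show ?case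
      by (simp add: \<mu>_def mult_ac)
  qed
qed

end
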